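(* Let $q$ be a prime power and $n,r$ positive integers. Let $(U_1,\ldots,U_r)$ and $(W_1,\ldots,W_r)$ be two families each consisting of $r$ distinct $\mathbb{F}_q$-subspaces of $\mathbb{F}_{q^n}$, all of dimension greater than one. Suppose that $\dim_{\mathbb{F}_q}(U_i\cap\alpha U_j)\leq 1$ and $\dim_{\mathbb{F}_q}(W_i\cap\alpha W_j)\leq 1$ for every $\alpha\in\mathbb{F}_{q^n}$ and all $i,j\in\{1,\ldots,r\}$ with $i\neq j$. Then $\{U_1,\ldots,U_r\}$ and $\{W_1,\ldots,W_r\}$ are equivalent if and only if there exist a permutation $\sigma\in S_r$, elements $\lambda_1,\ldots,\lambda_r\in\mathbb{F}_{q^n}^*$ and $\rho\in\mathrm{Aut}(\mathbb{F}_{q^n})$ such that $W_i=\lambda_iU_{\sigma(i)}^\rho$ for every $i\in\{1,\ldots,r\}$. In particular, in that case $\dim_{\mathbb{F}_q}(W_i)=\dim_{\mathbb{F}_q}(U_{\sigma(i)})$ for every $i$.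
   Context: $\mathrm{\Gamma L}(r,q^n)=\mathrm{GL}(r,q^n)\rtimes\mathrm{Aut}(\mathbb{F}_{q^n})$ acts on $\mathbb{F}_{q^n}^r$ by semilinear maps. Two families $\{U_1,\ldots,U_r\}$ and $\{W_1,\ldots,W_r\}$ of $r$ distinct $\mathbb{F}_q$-subspaces of $\mathbb{F}_{q^n}$ are called equivalent if there exists $\varphi\in\mathrm{\Gamma L}(r,q^n)$ with $\varphi(U_1\times\cdots\times U_r)=W_1\times\cdots\times W_r$. For $\rho\in\mathrm{Aut}(\mathbb{F}_{q^n})$, $U^\rho=\{u^\rho: u\in U\}$; $\alpha U=\{\alpha u:u\in U\}$. *)

theory Defs
  imports
    Complex_Main
    "HOL-Library.Set_Algebras"
    "HOL-Library.Cardinality"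
    "HOL-Combinatorics.Permutations"
    "HOL-Number_Theory.Prime_Powers"
    "Jordan_Normal_Form.Matrix"
begin

text \<open>
  The field of order q is a type \<open>'k\<close>, its extension of degree n a type \<open>'a\<close>, and the
  inclusion of the former in the latter is a field homomorphism \<open>\<iota>\<close>.  As the image of \<open>\<iota>\<close> is
  the unique subfield of order q, none of the notions below depends on the choice of \<open>\<iota>\<close>.
\<close>

definition ext_scale :: "('k::field \<Rightarrow> 'a::field) \<Rightarrow> 'k \<Rightarrow> 'a \<Rightarrow> 'a" where
  "ext_scale \<iota> c x = \<iota> c * x"

lemma vector_space_ext_scale:
  assumes "field_hom \<iota>"
  shows "vector_space (ext_scale \<iota>)"
proof -
  interpret field_hom \<iota> by (rule assms)
  show ?thesis
    by unfold_locales (simp_all add: ext_scale_def hom_distribs algebra_simps)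
qed

abbreviation ext_subspace :: "('k::field \<Rightarrow> 'a::field) \<Rightarrow> 'a set \<Rightarrow> bool" where
  "ext_subspace \<iota> \<equiv> Modules.module.subspace (ext_scale \<iota>)"

abbreviation ext_dim :: "('k::field \<Rightarrow> 'a::field) \<Rightarrow> 'a set \<Rightarrow> nat" where
  "ext_dim \<iota> \<equiv> Vector_Spaces.vector_space.dim (ext_scale \<iota>)"

abbreviation field_automorphism :: "('a::field \<Rightarrow> 'a) \<Rightarrow> bool" where
  "field_automorphism \<rho> \<equiv> field_isom \<rho>"

definition general_linear :: "nat \<Rightarrow> 'a::field mat set" where
  "general_linear r = {A \<in> carrier_mat r r. invertible_mat A}"

text \<open>
  The group of invertible semilinear maps is represented by the action of its elements:
  the pair \<open>(A, \<rho>)\<close> of the semidirect product maps v to \<open>A v\<^sup>\<rho>\<close>, with \<open>\<rho>\<close> applied entrywise.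
\<close>

definition semilinear_action :: "'a::field mat \<Rightarrow> ('a \<Rightarrow> 'a) \<Rightarrow> 'a vec \<Rightarrow> 'a vec" where
  "semilinear_action A \<rho> v = A *\<^sub>v map_vec \<rho> v"

definition general_semilinear :: "nat \<Rightarrow> ('a::field vec \<Rightarrow> 'a vec) set" where
  "general_semilinear r =
     {semilinear_action A \<rho> | A \<rho>. A \<in> general_linear r \<and> field_automorphism \<rho>}"

text \<open>
  Families are indexed by \<open>{..<r}\<close>.  Equivalence does not depend on the order of the members,
  because permuting the coordinates is linear.
\<close>

definition family_prod :: "nat \<Rightarrow> (nat \<Rightarrow> 'a set) \<Rightarrow> 'a vec set" where
  "family_prod r U = {v \<in> carrier_vec r. \<forall>i<r. v $ i \<in> U i}"

definition equivalent_families :: "nat \<Rightarrow> (nat \<Rightarrow> 'a::field set) \<Rightarrow> (nat \<Rightarrow> 'a set) \<Rightarrow> bool" where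
  "equivalent_families r U W \<longleftrightarrow>
     (\<exists>\<phi> \<in> general_semilinear r. \<phi> ` family_prod r U = family_prod r W)"

end

theory Submission
  imports Defs
begin

text \<open>
  Write \<open>\<phi> v = A v\<^sup>\<rho>\<close>.  Testing \<open>\<phi>\<close> on vectors supported on one coordinate gives
  \<open>a\<^sub>i\<^sub>j U\<^sub>j\<^sup>\<rho> \<subseteq> W\<^sub>i\<close>.  If column \<open>j\<close> had two non-zero entries \<open>a\<close> and \<open>a'\<close>, in rows \<open>i\<close> and \<open>i'\<close>,
  then \<open>a U\<^sub>j\<^sup>\<rho> \<subseteq> W\<^sub>i \<inter> (a / a') W\<^sub>i\<^sub>'\<close> would violate the dimension bound.  No row vanishes, as no
  \<open>W\<^sub>i\<close> does, so \<open>A\<close> is monomial.  Dimensions are compared through cardinalities, which are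
  visibly unchanged by \<open>\<rho>\<close>, although \<open>\<rho>\<close> is only semilinear over the small field.
\<close>

section \<open>Cardinality and dimension over a finite field\<close>

text \<open>Taking linear combinations is a bijection from the coefficient functions on
  \<open>B\<close> to the span: independence makes it injective. This count lets cardinality
  determine dimension.\<close>

lemma (in vector_space) card_span_independent:
  assumes "finite (UNIV :: 'a set)" and "finite B" and "independent B"
  shows "card (span B) = CARD('a) ^ card B"
proof -
  let ?f = "\<lambda>u. \<Sum>v\<in>B. u v *s v"
  have "inj_on ?f (B \<rightarrow>\<^sub>E UNIV)"
  proof (rule inj_onI)
    fix u w assume u: "u \<in> B \<rightarrow>\<^sub>E UNIV" and w: "w \<in> B \<rightarrow>\<^sub>E UNIV" and eq: "?f u = ?f w"
    have "(\<Sum>v\<in>B. (u v - w v) *s v) = 0"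
      using eq by (simp add: scale_left_diff_distrib sum_subtractf)
    then have "u v = w v" if "v \<in> B" for v
      using independentD[OF assms(3) assms(2) subset_refl, of "\<lambda>v. u v - w v"] that by simp
    then show "u = w"
      using u w by (rule_tac PiE_ext)
  qed
  moreover have "?f ` (B \<rightarrow>\<^sub>E UNIV) = span B"
  proof -
    \<comment> \<open>\<open>span_finite\<close> allows arbitrary coefficient functions; only their
      values on \<open>B\<close> enter the sum, so each may be replaced by its extensional
      restriction.\<close>
    have "?f u \<in> ?f ` (B \<rightarrow>\<^sub>E UNIV)" for u
      by (rule image_eqI[where x = "restrict u B"]) (auto intro!: sum.cong)
    then show ?thesis
      unfolding span_finite[OF assms(2)] by blast
  qed
  ultimately have "card (span B) = card (B \<rightarrow>\<^sub>E (UNIV :: 'a set))"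
    using card_image by fastforce
  then show ?thesis
    using assms(2) by (simp add: card_PiE)
qed

lemma card_ext_subspace:
  fixes \<iota> :: "'k::{field,finite} \<Rightarrow> 'a::{field,finite}"
  assumes "field_hom \<iota>" and "ext_subspace \<iota> S"
  shows "card S = CARD('k) ^ ext_dim \<iota> S"
proof -
  interpret V: vector_space "ext_scale \<iota>"
    using assms(1) by (rule vector_space_ext_scale)
  obtain B where B: "B \<subseteq> S" "V.independent B" "S \<subseteq> V.span B" "card B = V.dim S"
    using V.basis_exists by blast
  have "V.span B = S"
    using B(1,3) assms(2) V.span_minimal by blast
  then show ?thesis
    using V.card_span_independent[of B] B by simp
qed

section \<open>Scaled and semilinear images of subspaces\<close>

lemma ext_subspace_elt_set_times:
  assumes "field_hom \<iota>" and "ext_subspace \<iota> S"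
  shows "ext_subspace \<iota> (a *o S)"
proof -
  interpret V: vector_space "ext_scale \<iota>"
    using assms(1) by (rule vector_space_ext_scale)
  show ?thesis
  proof (rule V.subspaceI)
    show "0 \<in> a *o S"
      using V.subspace_0[OF assms(2)] by (force simp: elt_set_times_def)
  next
    fix x y assume "x \<in> a *o S" "y \<in> a *o S"
    then show "x + y \<in> a *o S"
      using V.subspace_add[OF assms(2)]
      by (auto simp: elt_set_times_def distrib_left[symmetric])
  next
    fix c x assume "x \<in> a *o S"
    then show "ext_scale \<iota> c x \<in> a *o S"
      using V.subspace_scale[OF assms(2), of _ c]
      by (force simp: elt_set_times_def ext_scale_def mult.left_commute)
  qed
qed

lemma card_elt_set_times_image:
  fixes a :: "'a::field"
  assumes "a \<noteq> 0" and "field_automorphism \<rho>"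
  shows "card (a *o (\<rho> ` U)) = card U"
proof -
  interpret field_isom \<rho> by (rule assms(2))
  have "a *o (\<rho> ` U) = (\<lambda>x. a * \<rho> x) ` U"
    by (auto simp: elt_set_times_def)
  moreover have "inj_on (\<lambda>x. a * \<rho> x) U"
    using assms(1) by (auto intro!: inj_onI)
  ultimately show ?thesis
    by (simp add: card_image)
qed

text \<open>Both sets have the same number of elements, and this number is a power of
  \<open>CARD('k)\<close> whose exponent is the dimension. In the application the image is a member
  \<open>W i\<close>, hence a subspace by assumption.\<close>

lemma ext_dim_elt_set_times_image:
  fixes \<iota> :: "'k::{field,finite} \<Rightarrow> 'a::{field,finite}"
  assumes "field_hom \<iota>" and "ext_subspace \<iota> U" and "ext_subspace \<iota> (a *o (\<rho> ` U))"
    and "a \<noteq> 0" and "field_automorphism \<rho>"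
  shows "ext_dim \<iota> (a *o (\<rho> ` U)) = ext_dim \<iota> U"
proof -
  have "CARD('k) ^ ext_dim \<iota> (a *o (\<rho> ` U)) = CARD('k) ^ ext_dim \<iota> U"
    using card_ext_subspace[OF assms(1,2)] card_ext_subspace[OF assms(1,3)]
      card_elt_set_times_image[OF assms(4,5)] by metis
  moreover have "CARD('k) > 1"
    using card_mono[of "UNIV :: 'k set" "{0, 1}"] by simp
  ultimately show ?thesis
    using power_inject_exp by blast
qed

text \<open>The semilinear image enters only as a subset of \<open>S\<close> with as many elements
  as \<open>U\<close>; the dimensions compared are those of the two given subspaces.\<close>

lemma ext_dim_le_of_elt_set_times_image_subset:
  fixes \<iota> :: "'k::{field,finite} \<Rightarrow> 'a::{field,finite}"
  assumes "field_hom \<iota>" and "ext_subspace \<iota> U" and "ext_subspace \<iota> S"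
    and "a \<noteq> 0" and "field_automorphism \<rho>" and "a *o (\<rho> ` U) \<subseteq> S"
  shows "ext_dim \<iota> U \<le> ext_dim \<iota> S"
proof -
  have "card U \<le> card S"
    using card_elt_set_times_image[OF assms(4,5), of U] card_mono[OF _ assms(6)] by simp
  then have "CARD('k) ^ ext_dim \<iota> U \<le> CARD('k) ^ ext_dim \<iota> S"
    using card_ext_subspace[OF assms(1)] assms(2,3) by metis
  moreover have "CARD('k) > 1"
    using card_mono[of "UNIV :: 'k set" "{0, 1}"] by simp
  ultimately show ?thesis
    using power_increasing_iff by blast
qed

section \<open>Semilinear maps in coordinates\<close>

lemma index_semilinear_action:
  assumes "A \<in> carrier_mat r r" and "v \<in> carrier_vec r" and "i < r"
  shows "semilinear_action A \<rho> v $ i = (\<Sum>j<r. A $$ (i, j) * \<rho> (v $ j))"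
  using assms by (simp add: semilinear_action_def scalar_prod_def atLeast0LessThan)

lemma semilinear_action_carrier:
  assumes "A \<in> carrier_mat r r" and "v \<in> carrier_vec r"
  shows "semilinear_action A \<rho> v \<in> carrier_vec r"
  using assms by (simp add: semilinear_action_def)

lemma entry_times_image_subset:
  fixes A :: "'a::field mat"
  assumes A: "A \<in> carrier_mat r r" and \<rho>: "field_automorphism \<rho>"
    and sub: "semilinear_action A \<rho> ` family_prod r U \<subseteq> family_prod r W"
    and zero: "\<And>k. k < r \<Longrightarrow> 0 \<in> U k" and "i < r" and "j < r"
  shows "A $$ (i, j) *o (\<rho> ` U j) \<subseteq> W i"
proof
  interpret field_isom \<rho> by (rule \<rho>)
  fix x assume "x \<in> A $$ (i, j) *o (\<rho> ` U j)"
  then obtain u where u: "u \<in> U j" and x: "x = A $$ (i, j) * \<rho> u"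
    by (auto simp: elt_set_times_def)
  \<comment> \<open>Each \<open>U k\<close> contains 0, so this vector lies in the product; as
    \<open>\<rho> 0 = 0\<close>, its image has \<open>A $$ (i, j) * \<rho> u\<close> as coordinate
    \<open>i\<close>.\<close>
  define v where "v = vec r (\<lambda>k. if k = j then u else 0)"
  have "v \<in> family_prod r U"
    using u zero by (auto simp: v_def family_prod_def)
  then have "semilinear_action A \<rho> v $ i \<in> W i"
    using sub \<open>i < r\<close> by (auto simp: family_prod_def)
  moreover have "semilinear_action A \<rho> v $ i = (\<Sum>k<r. if k = j then x else 0)"
    unfolding index_semilinear_action[OF A vec_carrier[of r "\<lambda>k. if k = j then u else 0"]
      \<open>i < r\<close>, folded v_def]
    by (intro sum.cong) (auto simp: v_def x)
  ultimately show "x \<in> W i"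
    using \<open>j < r\<close> by simp
qed

text \<open>Padding with zeros lifts an element of one factor to the product, so that an equality of
  products can be read off factor by factor.\<close>

lemma family_prod_surj:
  assumes zero: "\<And>k. k < r \<Longrightarrow> 0 \<in> W k" and "i < r" and "w \<in> W i"
  obtains v where "v \<in> family_prod r W" and "v $ i = w"
proof
  show "vec r (\<lambda>k. if k = i then w else 0) \<in> family_prod r W"
    using assms by (auto simp: family_prod_def)
qed (use assms in simp)

section \<open>Monomial matrices yield equivalences\<close>

lemma monomial_mat_invertible:
  fixes l :: "nat \<Rightarrow> 'a::field"
  assumes \<sigma>: "\<sigma> permutes {..<r}" and l: "\<And>i. i < r \<Longrightarrow> l i \<noteq> 0"
  shows "mat r r (\<lambda>(i, j). if j = \<sigma> i then l i else 0) \<in> general_linear r" (is "?A \<in> _")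
proof -
  \<comment> \<open>The inverse of a monomial matrix: transpose the pattern and invert the non-zero
    entries.\<close>
  let ?B = "mat r r (\<lambda>(j, i). if j = \<sigma> i then inverse (l i) else 0)"
  have \<sigma>_less: "\<sigma> i < r" if "i < r" for i
    using permutes_in_image[OF \<sigma>, of i] that by simp
  have \<sigma>_eq: "\<sigma> i = \<sigma> k \<longleftrightarrow> i = k" for i k
    using permutes_inj[OF \<sigma>] by (auto dest: injD)
  have "?A * ?B = 1\<^sub>m r"
  proof (rule eq_matI)
    fix i k assume ik: "i < dim_row (1\<^sub>m r :: 'a mat)" "k < dim_col (1\<^sub>m r :: 'a mat)"
    have mult: "(?A * ?B) $$ (i, k) = (\<Sum>j<r. ?A $$ (i, j) * ?B $$ (j, k))"
      using ik by (simp add: scalar_prod_def atLeast0LessThan)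
    have "(?A * ?B) $$ (i, k)
        = (\<Sum>j<r. if j = \<sigma> i then (if i = k then 1 else 0) else 0)"
      unfolding mult using ik l \<sigma>_eq by (intro sum.cong) auto
    then show "(?A * ?B) $$ (i, k) = 1\<^sub>m r $$ (i, k)"
      using ik \<sigma>_less by simp
  qed auto
  moreover have "?B * ?A = 1\<^sub>m r"
  proof (rule eq_matI)
    fix j k assume jk: "j < dim_row (1\<^sub>m r :: 'a mat)" "k < dim_col (1\<^sub>m r :: 'a mat)"
    obtain i where i: "i < r" "j = \<sigma> i"
      using jk permutes_image[OF \<sigma>] by (metis imageE index_one_mat(2) lessThan_iff)
    have mult: "(?B * ?A) $$ (j, k) = (\<Sum>i<r. ?B $$ (j, i) * ?A $$ (i, k))"
      using jk by (simp add: scalar_prod_def atLeast0LessThan)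
    have "(?B * ?A) $$ (j, k) = (\<Sum>i'<r. if i' = i then (if j = k then 1 else 0) else 0)"
      unfolding mult using jk l i \<sigma>_eq by (intro sum.cong) auto
    then show "(?B * ?A) $$ (j, k) = 1\<^sub>m r $$ (j, k)"
      using jk i by simp
  qed auto
  ultimately show ?thesis
    unfolding general_linear_def invertible_mat_def inverts_mat_def by auto
qed

lemma equivalent_familiesI:
  fixes U W :: "nat \<Rightarrow> 'a::field set"
  assumes \<sigma>: "\<sigma> permutes {..<r}" and l: "\<And>i. i < r \<Longrightarrow> l i \<noteq> 0"
    and \<rho>: "field_automorphism \<rho>" and W: "\<And>i. i < r \<Longrightarrow> W i = l i *o (\<rho> ` U (\<sigma> i))"
  shows "equivalent_families r U W"
proof -
  define A where "A = mat r r (\<lambda>(i, j). if j = \<sigma> i then l i else 0)"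
  have A: "A \<in> carrier_mat r r"
    by (simp add: A_def)
  have \<sigma>_less: "\<sigma> i < r" if "i < r" for i
    using permutes_in_image[OF \<sigma>, of i] that by simp
  have act: "semilinear_action A \<rho> v $ i = l i * \<rho> (v $ \<sigma> i)"
    if "v \<in> carrier_vec r" "i < r" for v i
  proof -
    have "semilinear_action A \<rho> v $ i = (\<Sum>j<r. if j = \<sigma> i then l i * \<rho> (v $ j) else 0)"
      unfolding index_semilinear_action[OF A that] using that
      by (intro sum.cong) (auto simp: A_def)
    then show ?thesis
      using \<sigma>_less[OF that(2)] by simp
  qed
  have "semilinear_action A \<rho> ` family_prod r U = family_prod r W"
  proof (intro equalityI subsetI)
    fix y assume "y \<in> semilinear_action A \<rho> ` family_prod r U"
    then obtain v where v: "v \<in> carrier_vec r" "\<And>i. i < r \<Longrightarrow> v $ i \<in> U i"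
      and y: "y = semilinear_action A \<rho> v"
      by (auto simp: family_prod_def)
    then show "y \<in> family_prod r W"
      using semilinear_action_carrier[OF A v(1)] act[OF v(1)] W \<sigma>_less
      by (auto simp: family_prod_def elt_set_times_def)
  next
    fix w assume w: "w \<in> family_prod r W"
    have "\<exists>u. u \<in> U (\<sigma> i) \<and> w $ i = l i * \<rho> u" if "i < r" for i
      using w W that by (auto simp: family_prod_def elt_set_times_def)
    then obtain u where u: "\<And>i. i < r \<Longrightarrow> u i \<in> U (\<sigma> i) \<and> w $ i = l i * \<rho> (u i)"
      by metis
    \<comment> \<open>Coordinate \<open>\<sigma> i\<close> of the preimage has to be
      \<open>u i\<close>, hence the inverse permutation.\<close>
    define v where "v = vec r (\<lambda>j. u (inv_into UNIV \<sigma> j))"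
    have inv_less: "inv_into UNIV \<sigma> j < r" if "j < r" for j
      using permutes_in_image[OF permutes_inv[OF \<sigma>], of j] that by simp
    have v: "v \<in> carrier_vec r"
      by (simp add: v_def)
    have "v \<in> family_prod r U"
      using u[OF inv_less] permutes_inverses(1)[OF \<sigma>] by (auto simp: family_prod_def v_def)
    moreover have "semilinear_action A \<rho> v = w"
    proof (rule eq_vecI)
      fix i assume "i < dim_vec w"
      then have i: "i < r"
        using w by (auto simp: family_prod_def)
      show "semilinear_action A \<rho> v $ i = w $ i"
        unfolding act[OF v i] using u[OF i] \<sigma>_less[OF i] permutes_inverses(2)[OF \<sigma>, of i]
        by (simp add: v_def)
    qed (use semilinear_action_carrier[OF A v] w in \<open>auto simp: family_prod_def\<close>)
    ultimately show "w \<in> semilinear_action A \<rho> ` family_prod r U"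
      by blast
  qed
  moreover have "A \<in> general_linear r"
    unfolding A_def using \<sigma> l by (rule monomial_mat_invertible)
  ultimately show ?thesis
    using \<rho> by (auto simp: equivalent_families_def general_semilinear_def)
qed

section \<open>Equivalences come from monomial matrices\<close>

lemma equivalent_familiesE:
  fixes \<iota> :: "'k::{field,finite} \<Rightarrow> 'a::{field,finite}"
  assumes \<iota>: "field_hom \<iota>" and equiv: "equivalent_families r U W"
    and subU: "\<And>i. i < r \<Longrightarrow> ext_subspace \<iota> (U i)"
    and subW: "\<And>i. i < r \<Longrightarrow> ext_subspace \<iota> (W i)"
    and dimU: "\<And>i. i < r \<Longrightarrow> ext_dim \<iota> (U i) > 1"
    and dimW: "\<And>i. i < r \<Longrightarrow> ext_dim \<iota> (W i) > 1"
    and dim_int: "\<And>\<alpha> i j. i < r \<Longrightarrow> j < r \<Longrightarrow> i \<noteq> j \<Longrightarrow> ext_dim \<iota> (W i \<inter> \<alpha> *o W j) \<le> 1"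
  obtains \<sigma> l \<rho> where "\<sigma> permutes {..<r}" and "\<And>i. i < r \<Longrightarrow> l i \<noteq> 0"
    and "field_automorphism \<rho>" and "\<And>i. i < r \<Longrightarrow> W i = l i *o (\<rho> ` U (\<sigma> i))"
proof -
  interpret V: vector_space "ext_scale \<iota>"
    using \<iota> by (rule vector_space_ext_scale)
  obtain A \<rho> where A: "A \<in> carrier_mat r r" and \<rho>: "field_automorphism \<rho>"
    and img: "semilinear_action A \<rho> ` family_prod r U = family_prod r W"
    using equiv
    by (auto simp: equivalent_families_def general_semilinear_def general_linear_def)
  have zeroU: "0 \<in> U i" and zeroW: "0 \<in> W i" if "i < r" for i
    using subU subW that V.subspace_0 by auto
  have entry: "A $$ (i, j) *o (\<rho> ` U j) \<subseteq> W i" if "i < r" "j < r" for i j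
    using entry_times_image_subset[OF A \<rho> eq_refl[OF img] zeroU that] .
  have preimage: "\<exists>v. (\<forall>j<r. v $ j \<in> U j) \<and> w = (\<Sum>j<r. A $$ (i, j) * \<rho> (v $ j))"
    if iw: "i < r" "w \<in> W i" for i w
  proof -
    obtain y where y: "y \<in> family_prod r W" "y $ i = w"
      using family_prod_surj[of r W, OF zeroW iw] .
    then obtain v where v: "v \<in> family_prod r U" "y = semilinear_action A \<rho> v"
      unfolding img[symmetric] by blast
    then show ?thesis
      using y index_semilinear_action[OF A _ iw(1), of v] by (auto simp: family_prod_def)
  qed
  \<comment> \<open>A zero row would make every coordinate \<open>i\<close> in the image vanish,
    leaving \<open>W i\<close> with at most one element although its dimension is positive.\<close>
  have "\<exists>j<r. A $$ (i, j) \<noteq> 0" if i: "i < r" for i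
  proof (rule ccontr)
    assume "\<not> (\<exists>j<r. A $$ (i, j) \<noteq> 0)"
    then have "W i \<subseteq> {0}"
      using preimage[OF i] by auto
    then have "card (W i) \<le> 1"
      using card_mono[of "{0}" "W i"] by simp
    moreover have "CARD('k) > 1"
      using card_mono[of "UNIV :: 'k set" "{0, 1}"] by simp
    then have "card (W i) > 1"
      unfolding card_ext_subspace[OF \<iota> subW[OF i]]
      using dimW[OF i] by (intro one_less_power) simp_all
    ultimately show False
      by simp
  qed
  then obtain s where s: "\<And>i. i < r \<Longrightarrow> s i < r \<and> A $$ (i, s i) \<noteq> 0"
    by metis
  have col: "i = k"
    if ik: "i < r" "k < r" and j: "j < r" and nz: "A $$ (i, j) \<noteq> 0" "A $$ (k, j) \<noteq> 0" for i k j
  proof (rule ccontr)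
    assume "i \<noteq> k"
    \<comment> \<open>This factor carries \<open>A $$ (k, j) * \<rho> u\<close>, an element of
      \<open>W k\<close>, to \<open>A $$ (i, j) * \<rho> u\<close>, an element of
      \<open>W i\<close>. The intersection then has at least the dimension of \<open>U j\<close>,
      which exceeds one.\<close>
    let ?\<alpha> = "A $$ (i, j) / A $$ (k, j)"
    have "A $$ (i, j) * \<rho> u \<in> ?\<alpha> *o W k" if "u \<in> U j" for u
    proof -
      have "A $$ (k, j) * \<rho> u \<in> W k"
        using entry[OF ik(2) j] that by (auto simp: elt_set_times_def)
      moreover have "A $$ (i, j) * \<rho> u = ?\<alpha> * (A $$ (k, j) * \<rho> u)"
        using nz by simp
      ultimately show ?thesis
        unfolding elt_set_times_def by blast
    qed
    then have "A $$ (i, j) *o (\<rho> ` U j) \<subseteq> W i \<inter> ?\<alpha> *o W k"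
      using entry[OF ik(1) j] by (auto simp: elt_set_times_def)
    moreover have "ext_subspace \<iota> (W i \<inter> ?\<alpha> *o W k)"
      using ik subW ext_subspace_elt_set_times[OF \<iota>] by (intro V.subspace_inter) auto
    ultimately have "ext_dim \<iota> (U j) \<le> ext_dim \<iota> (W i \<inter> ?\<alpha> *o W k)"
      using ext_dim_le_of_elt_set_times_image_subset[OF \<iota> subU[OF j]] nz(1) \<rho> by blast
    then show False
      using dim_int[OF ik \<open>i \<noteq> k\<close>, of ?\<alpha>] dimU[OF j] by linarith
  qed
  \<comment> \<open>Rows \<open>i\<close> and \<open>k\<close> with \<open>s i = s k\<close> would
    both have a non-zero entry in that column. An injective self-map of a finite set is
    bijective.\<close>
  have "inj_on s {..<r}"
    using s col by (intro inj_onI) (metis lessThan_iff)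
  moreover have "s ` {..<r} \<subseteq> {..<r}"
    using s by auto
  ultimately have bij: "bij_betw s {..<r} {..<r}"
    by (simp add: bij_betw_def endo_inj_surj)
  \<comment> \<open>By surjectivity column \<open>j\<close> already has its one non-zero entry in
    some row \<open>k\<close> with \<open>j = s k\<close>; by \<open>col\<close> this row is
    \<open>i\<close>.\<close>
  have row: "j = s i" if "i < r" "j < r" "A $$ (i, j) \<noteq> 0" for i j
  proof -
    obtain k where "k < r" "j = s k"
      using bij \<open>j < r\<close> by (metis bij_betw_imp_surj_on imageE lessThan_iff)
    then show ?thesis
      using col[of i k j] s[of k] that by auto
  qed
  \<comment> \<open>\<open>permutes\<close> requires the identity outside the index set.\<close>
  define \<sigma> where "\<sigma> i = (if i < r then s i else i)" for i
  have "\<sigma> permutes {..<r}"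
    using bij bij_betw_cong[of "{..<r}" \<sigma> s] by (intro bij_imp_permutes) (auto simp: \<sigma>_def)
  moreover have "W i = A $$ (i, \<sigma> i) *o (\<rho> ` U (\<sigma> i))" if i: "i < r" for i
  proof
    show "A $$ (i, \<sigma> i) *o (\<rho> ` U (\<sigma> i)) \<subseteq> W i"
      using entry i s by (simp add: \<sigma>_def)
    \<comment> \<open>Row \<open>i\<close> has a single non-zero entry, so the sum expressing an
      element of \<open>W i\<close> through its preimage reduces to one term.\<close>
    show "W i \<subseteq> A $$ (i, \<sigma> i) *o (\<rho> ` U (\<sigma> i))"
    proof
      fix w assume "w \<in> W i"
      then obtain v where v: "\<forall>j<r. v $ j \<in> U j" and w: "w = (\<Sum>j<r. A $$ (i, j) * \<rho> (v $ j))"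
        using preimage[OF i] by blast
      have "w = (\<Sum>j<r. if j = s i then A $$ (i, j) * \<rho> (v $ j) else 0)"
        unfolding w using row[OF i] by (intro sum.cong) auto
      then have "w = A $$ (i, s i) * \<rho> (v $ s i)"
        using s[OF i] by simp
      then show "w \<in> A $$ (i, \<sigma> i) *o (\<rho> ` U (\<sigma> i))"
        using v s[OF i] i by (auto simp: elt_set_times_def \<sigma>_def)
    qed
  qed
  ultimately show ?thesis
    using that[of \<sigma> "\<lambda>i. A $$ (i, \<sigma> i)" \<rho>] s \<rho> by (simp add: \<sigma>_def)
qed

section \<open>The criterion and the equality of dimensions\<close>

theorem theorem4p2:
  fixes q n r :: nat
    and \<iota> :: "'k::{field,finite} \<Rightarrow> 'a::{field,finite}"
    and U W :: "nat \<Rightarrow> 'a set"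
  assumes "primepow q" and "n > 0" and "r > 0"
    and "CARD('k) = q" and "CARD('a) = q ^ n" and "field_hom \<iota>"
    and "\<And>i. i < r \<Longrightarrow> ext_subspace \<iota> (U i)"
    and "\<And>i. i < r \<Longrightarrow> ext_subspace \<iota> (W i)"
    and "inj_on U {..<r}" and "inj_on W {..<r}"
    and "\<And>i. i < r \<Longrightarrow> ext_dim \<iota> (U i) > 1"
    and "\<And>i. i < r \<Longrightarrow> ext_dim \<iota> (W i) > 1"
    and "\<And>\<alpha> i j. i < r \<Longrightarrow> j < r \<Longrightarrow> i \<noteq> j \<Longrightarrow> ext_dim \<iota> (U i \<inter> \<alpha> *o U j) \<le> 1"
    and "\<And>\<alpha> i j. i < r \<Longrightarrow> j < r \<Longrightarrow> i \<noteq> j \<Longrightarrow> ext_dim \<iota> (W i \<inter> \<alpha> *o W j) \<le> 1"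
  shows "(equivalent_families r U W \<longleftrightarrow>
            (\<exists>\<sigma> l \<rho>. \<sigma> permutes {..<r} \<and> (\<forall>i<r. l i \<noteq> 0) \<and> field_automorphism \<rho> \<and>
               (\<forall>i<r. W i = l i *o (\<rho> ` U (\<sigma> i)))))
       \<and> (\<forall>\<sigma> l \<rho>. \<sigma> permutes {..<r} \<and> (\<forall>i<r. l i \<noteq> 0) \<and> field_automorphism \<rho> \<and>
               (\<forall>i<r. W i = l i *o (\<rho> ` U (\<sigma> i)))
            \<longrightarrow> (\<forall>i<r. ext_dim \<iota> (W i) = ext_dim \<iota> (U (\<sigma> i))))"
proof (intro conjI iffI allI impI)
  assume "equivalent_families r U W"
  then show "\<exists>\<sigma> l \<rho>. \<sigma> permutes {..<r} \<and> (\<forall>i<r. l i \<noteq> 0) \<and> field_automorphism \<rho> \<and>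
      (\<forall>i<r. W i = l i *o (\<rho> ` U (\<sigma> i)))"
    by (rule equivalent_familiesE[OF assms(6) _ assms(7,8,11,12,14)]) blast+
next
  assume "\<exists>\<sigma> l \<rho>. \<sigma> permutes {..<r} \<and> (\<forall>i<r. l i \<noteq> 0) \<and> field_automorphism \<rho> \<and>
      (\<forall>i<r. W i = l i *o (\<rho> ` U (\<sigma> i)))"
  then show "equivalent_families r U W"
    using equivalent_familiesI by blast
next
  fix \<sigma> l \<rho> i
  assume H: "\<sigma> permutes {..<r} \<and> (\<forall>i<r. l i \<noteq> 0) \<and> field_automorphism \<rho> \<and>
      (\<forall>i<r. W i = l i *o (\<rho> ` U (\<sigma> i)))" and i: "i < r"
  have "\<sigma> i < r"
    using H i permutes_in_image[of \<sigma> "{..<r}" i] by simp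
  moreover have "W i = l i *o (\<rho> ` U (\<sigma> i))"
    using H i by blast
  \<comment> \<open>Since the scaled image equals \<open>W i\<close>, the assumption on
    \<open>W\<close> provides the subspace property that the comparison of cardinalities
    requires.\<close>
  ultimately show "ext_dim \<iota> (W i) = ext_dim \<iota> (U (\<sigma> i))"
    using ext_dim_elt_set_times_image[OF assms(6) assms(7), of "\<sigma> i" "l i" \<rho>]
      assms(8)[OF i] H i by simp
qed

end
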